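(* Let $L$ be a fully interpreted language without a truth predicate, and let $\mathcal L$, $D$, $W$, $G$ be as in the context. Let $\mathcal C$ be the family of consistent subsets of $D$. Consider all transfinite sequences $(U_\lambda)_{\lambda<\alpha}$ of members of $\mathcal C$ ($\alpha$ an ordinal) such that $(U_\lambda)_{\lambda<\alpha}$ is strictly increasing (i.e. $U_\mu\subsetneq U_\nu$ whenever $\mu<\nu<\alpha$), $U_0=W$, and $U_\mu=\bigcup_{\lambda<\mu}G(U_\lambda)$ whenever $0<\mu<\alpha$. Then the union of all these sequences (viewed as functions on ordinals) is a transfinite sequence. It has a last member, and this last member is the smallest consistent subset $U$ of $D$ which satisfies $U=G(U)$.
   Context: **Languages.** A language is a countably infinite set of well-formed sentences of finite length over a countable set of symbols, including numerals for natural numbers. Connectives are syntactic operations with unique readability. The language $L$ is closed under $\neg,\vee,\wedge,\rightarrow,\leftrightarrow$, and the components of a compound sentence of $L$ are sentences of $L$. A predicate $P$ with (nonempty) domain $X_P$ is a formula $P(x)$ (possibly with $x$ a tuple of variables) such that $P(x)$ is a sentence for each assignment of $x\in X_P$. For every predicate $P$ of $L$, $\forall xP(x)$ and $\exists xP(x)$ are sentences of $L$. **Fully interpreted.** A language is fully interpreted if every sentence is either true or false (not both) and the classical rules for $\neg,\vee,\wedge,\rightarrow,\leftrightarrow$ hold, and for a predicate $P$ with domain $X_P$, $\forall xP(x)$ is true iff $P(x)$ is true for every $x\in X_P$ (false iff false for some $x\in X_P$), and $\exists xP(x)$ is true iff $P(x)$ is true for some $x\in X_P$ (false iff false for every $x\in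 X_P$). **The language $\mathcal L$.** $L$ is a fully interpreted language without a truth predicate; $T(x)$ is a new formula not in $L$. $\mathcal L_0$ consists of the sentences of $L$, the sentences $T(\mathbf n)$ for all numerals $\mathbf n$, the sentences $\forall xT(x)$, $\exists xT(x)$, $\forall xT(\lceil T(x)\rceil)$, $\exists xT(\lceil T(x)\rceil)$, and, for every predicate $P$ of $L$, the sentences $\forall xT(\lceil P(x)\rceil)$, $\exists xT(\lceil P(x)\rceil)$ (all these are syntactically distinct and not in $L$). $\mathcal L_{n+1}$ consists of $A,\neg A,A\vee B,A\wedge B,A\rightarrow B,A\leftrightarrow B$ for $A,B\in\mathcal L_n$, and $\mathcal L=\bigcup_{n\ge0}\mathcal L_n$. A (injective) Gödel numbering is fixed; $\#A$ is the Gödel number of $A$, $\lceil A\rceil$ the numeral of $\#A$, and $D$ the set of Gödel numbers of all sentences of $\mathcal L$. $U\subseteq D$ is consistent if for no sentence $A$ of $\mathcal L$ both $\#A$ and $\#[\neg A]$ are in $U$. **The set $G(U)$.** Let $\mathcal P_1$ (resp. $\mathcal P_2$) be the set of predicates $P$ of $L$ with $P(x)$ true (resp. false) for every $x\in X_P$, and $\mathcal P_3$ the set of those with $P(x)$ true for some but not all $x\in X_P$. Let $W=\{\#A: A$ a true sentence of $L\}$. For a proper subset $U$ of $D$, put $G_0(\emptyset)=W$, and for $U\neq\emptyset$ let $G_0(U)$ be the union of $W$ and the following sets: $\{\#T(\lceil A\rceil): A\in\mathcal L,\ \#A\in U\}$; $\{\#[\neg T(\lceil A\rceil)]: A\in\mathcal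 L,\ \#[\neg A]\in U\}$; the Gödel numbers of $\neg\forall xT(x)$, $\exists xT(x)$, $\neg\forall xT(\lceil T(x)\rceil)$, $\exists xT(\lceil T(x)\rceil)$; of $\forall xT(\lceil P(x)\rceil)$, $\exists xT(\lceil P(x)\rceil)$ for $P\in\mathcal P_1$; of $\neg\forall xT(\lceil P(x)\rceil)$, $\neg\exists xT(\lceil P(x)\rceil)$ for $P\in\mathcal P_2$; of $\neg\forall xT(\lceil P(x)\rceil)$, $\exists xT(\lceil P(x)\rceil)$ for $P\in\mathcal P_3$. Given $G_n(U)$, let $G_{n+1}(U)$ be $G_n(U)$ together with, for all sentences $A,B$ of $\mathcal L$ (writing "$A\in G_n$" for $\#A\in G_n(U)$): $\#[\neg\neg A]$ if $A\in G_n$; $\#[A\vee B]$ if $A\in G_n$ or $B\in G_n$; $\#[A\wedge B]$ if $A,B\in G_n$; $\#[A\rightarrow B]$ if $\neg A\in G_n$ or $B\in G_n$; $\#[A\leftrightarrow B]$ if $A,B\in G_n$ or $\neg A,\neg B\in G_n$; $\#[\neg(A\vee B)]$ if $\neg A,\neg B\in G_n$; $\#[\neg(A\wedge B)]$ if $\neg A\in G_n$ or $\neg B\in G_n$; $\#[\neg(A\rightarrow B)]$ if $A,\neg B\in G_n$; $\#[\neg(A\leftrightarrow B)]$ if $A,\neg B\in G_n$ or $\neg A,B\in G_n$. Put $G(U)=\bigcup_{n\ge 0}G_n(U)$. (Consistent sets are proper subsets of $D$, so $G$ is defined on them.) *)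

theory Defs
  imports "HOL-Library.Countable_Set" "HOL-Library.Infinite_Typeclass"
begin

text \<open>
  Ordinals. HOL has no type of all ordinals. The type \<open>'i ordinal\<close> consists of the isomorphism
  classes of the well-orders whose field is a subset of \<open>'i\<close>, i.e. of all ordinals of cardinality
  at most that of \<open>'i\<close>. A statement that is polymorphic in an infinite type \<open>'i\<close> thus covers
  all ordinals.
\<close>

quotient_type 'i ordinal = "'i rel" / partial: "\<lambda>r s. (r, s) \<in> ordIso"
proof (rule part_equivpI)
  show "\<exists>r. ((r :: 'i rel), r) \<in> ordIso"
    using ordIso_reflexive card_of_Well_order by blast
  show "symp (\<lambda>r s. ((r :: 'i rel), s) \<in> ordIso)"
    by (auto intro!: sympI intro: ordIso_symmetric)
  show "transp (\<lambda>r s. ((r :: 'i rel), s) \<in> ordIso)"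
    by (auto intro!: transpI intro: ordIso_transitive)
qed

lemma Well_order_rep_ordinal: "Well_order (rep_ordinal a)"
  using Quotient3_rep_reflp[OF Quotient3_ordinal, of a] by (auto simp: ordIso_def)

lemma rep_ordinal_eq: "(rep_ordinal a, rep_ordinal b) \<in> ordIso \<longleftrightarrow> a = b"
  using Quotient3_rel_rep[OF Quotient3_ordinal] by blast

instantiation ordinal :: (type) wellorder
begin

definition less_eq_ordinal :: "'a ordinal \<Rightarrow> 'a ordinal \<Rightarrow> bool" where
  "a \<le> b \<longleftrightarrow> (rep_ordinal a, rep_ordinal b) \<in> ordLeq"

definition less_ordinal :: "'a ordinal \<Rightarrow> 'a ordinal \<Rightarrow> bool" where
  "a < b \<longleftrightarrow> (rep_ordinal a, rep_ordinal b) \<in> ordLess"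

instance
proof
  fix a b c :: "'a ordinal"
  show "(a < b) = (a \<le> b \<and> \<not> b \<le> a)"
    unfolding less_eq_ordinal_def less_ordinal_def
    using not_ordLess_iff_ordLeq Well_order_rep_ordinal ordLess_imp_ordLeq by blast
  show "a \<le> a"
    unfolding less_eq_ordinal_def using ordLeq_reflexive Well_order_rep_ordinal by blast
  show "a \<le> c" if "a \<le> b" "b \<le> c"
    using that unfolding less_eq_ordinal_def using ordLeq_transitive by blast
  show "a = b" if "a \<le> b" "b \<le> a"
    using that unfolding less_eq_ordinal_def
    using ordIso_iff_ordLeq rep_ordinal_eq by blast
  show "a \<le> b \<or> b \<le> a"
    unfolding less_eq_ordinal_def
    using ordLess_or_ordLeq Well_order_rep_ordinal ordLess_imp_ordLeq by blast
next
  fix P :: "'a ordinal \<Rightarrow> bool" and a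
  assume step: "\<And>x. (\<And>y. y < x \<Longrightarrow> P y) \<Longrightarrow> P x"
  have "wf (inv_image ordLess (rep_ordinal :: 'a ordinal \<Rightarrow> _))"
    by (rule wf_inv_image[OF wf_ordLess])
  then show "P a"
    by (rule wf_induct_rule) (auto intro: step simp: less_ordinal_def)
qed

end

instantiation ordinal :: (type) zero
begin

definition zero_ordinal :: "'a ordinal" where
  "0 = abs_ordinal {}"

instance ..

end

lemma zero_le_ordinal: "(0 :: 'i ordinal) \<le> a"
proof -
  have "({} :: 'i rel, {} :: 'i rel) \<in> ordIso"
    by (rule ordIso_reflexive) simp
  then have "(rep_ordinal (0 :: 'i ordinal), {} :: 'i rel) \<in> ordIso"
    unfolding zero_ordinal_def by (rule Quotient3_rep_abs[OF Quotient3_ordinal])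
  moreover have "({} :: 'i rel, rep_ordinal a) \<in> ordLeq"
    using Well_order_rep_ordinal[of a] by (auto simp: ordLeq_def embed_def)
  ultimately show ?thesis
    unfolding less_eq_ordinal_def by (rule ordIso_ordLeq_trans)
qed

text \<open>
  A transfinite sequence \<open>(U\<^sub>\<kappa>)\<close>, \<open>\<kappa> < \<alpha>\<close>, viewed as a function on an ordinal, is its graph.
\<close>

definition seq_graph :: "'i ordinal \<Rightarrow> ('i ordinal \<Rightarrow> 'b) \<Rightarrow> ('i ordinal \<times> 'b) set" where
  "seq_graph \<alpha> U = {(\<kappa>, U \<kappa>) | \<kappa>. \<kappa> < \<alpha>}"

definition transfinite_sequence :: "('i ordinal \<times> 'b) set \<Rightarrow> bool" where
  "transfinite_sequence S \<longleftrightarrow> (\<exists>\<alpha> U. S = seq_graph \<alpha> U)"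

definition last_member :: "('i ordinal \<times> 'b) set \<Rightarrow> 'b \<Rightarrow> bool" where
  "last_member S u \<longleftrightarrow> (\<exists>\<gamma>. (\<gamma>, u) \<in> S \<and> (\<forall>\<beta> v. (\<beta>, v) \<in> S \<longrightarrow> \<beta> \<le> \<gamma>))"

text \<open>
  Formulas are words over the symbols \<open>'c\<close>. The type \<open>'x\<close> contains the values of the variables
  (values of tuples of variables are also elements of \<open>'x\<close>). For a predicate \<open>P\<close>, the word
  \<open>inst L P x\<close> is the sentence \<open>P(x)\<close> for \<open>x \<in> dom_of L P\<close>, and \<open>all_of L P\<close>, \<open>ex_of L P\<close> are its
  universal and existential quantification. \<open>num_val L n\<close> is the value given to a variable when the
  numeral of \<open>n\<close> is put in its place. \<open>true_in L A\<close> means that the sentence \<open>A\<close> of \<open>L\<close> is true;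
  a sentence of \<open>L\<close> that is not true is false.
\<close>

datatype connective = Disj | Conj | Imp | Iff

record ('c, 'x) language =
  symbols :: "'c set"
  sentences :: "'c list set"
  neg :: "'c list \<Rightarrow> 'c list"
  bin :: "connective \<Rightarrow> 'c list \<Rightarrow> 'c list \<Rightarrow> 'c list"
  numeral_of :: "nat \<Rightarrow> 'c list"
  num_val :: "nat \<Rightarrow> 'x"
  predicates :: "'c list set"
  dom_of :: "'c list \<Rightarrow> 'x set"
  inst :: "'c list \<Rightarrow> 'x \<Rightarrow> 'c list"
  all_of :: "'c list \<Rightarrow> 'c list"
  ex_of :: "'c list \<Rightarrow> 'c list"
  true_in :: "'c list \<Rightarrow> bool"

text \<open>
  Unique readability is required on a set \<open>S\<close> of sentences only: a concrete syntax is in general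
  not uniquely readable on arbitrary words.
\<close>

definition compounds :: "('c, 'x, 'm) language_scheme \<Rightarrow> 'c list set \<Rightarrow> 'c list set" where
  "compounds L S = neg L ` S \<union> {bin L c A B | c A B. A \<in> S \<and> B \<in> S}"

definition uniquely_readable :: "('c, 'x, 'm) language_scheme \<Rightarrow> 'c list set \<Rightarrow> bool" where
  "uniquely_readable L S \<longleftrightarrow>
     inj_on (neg L) S \<and>
     (\<forall>c c'. \<forall>A \<in> S. \<forall>B \<in> S. \<forall>A' \<in> S. \<forall>B' \<in> S.
        bin L c A B = bin L c' A' B' \<longrightarrow> c = c' \<and> A = A' \<and> B = B') \<and>
     (\<forall>c. \<forall>A \<in> S. \<forall>B \<in> S. \<forall>C \<in> S. neg L C \<noteq> bin L c A B)"

definition language :: "('c, 'x, 'm) language_scheme \<Rightarrow> bool" where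
  "language L \<longleftrightarrow>
     countable (symbols L) \<and>
     infinite (sentences L) \<and> countable (sentences L) \<and> sentences L \<subseteq> lists (symbols L) \<and>
     inj (numeral_of L) \<and> range (numeral_of L) \<subseteq> lists (symbols L) \<and> inj (num_val L) \<and>
     (\<forall>A \<in> sentences L. neg L A \<in> sentences L) \<and>
     (\<forall>c. \<forall>A \<in> sentences L. \<forall>B \<in> sentences L. bin L c A B \<in> sentences L) \<and>
     uniquely_readable L (sentences L) \<and>
     predicates L \<subseteq> lists (symbols L) \<and>
     (\<forall>P \<in> predicates L.
        dom_of L P \<noteq> {} \<and> (\<forall>x \<in> dom_of L P. inst L P x \<in> sentences L) \<and>
        all_of L P \<in> sentences L \<and> ex_of L P \<in> sentences L)"

definition fully_interpreted :: "('c, 'x, 'm) language_scheme \<Rightarrow> bool" where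
  "fully_interpreted L \<longleftrightarrow>
     language L \<and>
     (\<forall>A \<in> sentences L. true_in L (neg L A) \<longleftrightarrow> \<not> true_in L A) \<and>
     (\<forall>A \<in> sentences L. \<forall>B \<in> sentences L.
        (true_in L (bin L Disj A B) \<longleftrightarrow> true_in L A \<or> true_in L B) \<and>
        (true_in L (bin L Conj A B) \<longleftrightarrow> true_in L A \<and> true_in L B) \<and>
        (true_in L (bin L Imp A B) \<longleftrightarrow> (true_in L A \<longrightarrow> true_in L B)) \<and>
        (true_in L (bin L Iff A B) \<longleftrightarrow> (true_in L A \<longleftrightarrow> true_in L B))) \<and>
     (\<forall>P \<in> predicates L.
        (true_in L (all_of L P) \<longleftrightarrow> (\<forall>x \<in> dom_of L P. true_in L (inst L P x))) \<and>
        (true_in L (ex_of L P) \<longleftrightarrow> (\<exists>x \<in> dom_of L P. true_in L (inst L P x))))"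

text \<open>
  The additional syntax: \<open>T_of M t\<close> is the formula \<open>T(t)\<close> for a term \<open>t\<close>, \<open>var M\<close> is the variable
  \<open>x\<close>, \<open>corner M P\<close> is the term \<open>\<lceil>P(x)\<rceil>\<close> (in which \<open>x\<close> is free) for a formula \<open>P(x)\<close>, and \<open>gn M A\<close>
  is the Goedel number of \<open>A\<close>.
\<close>

record ('c, 'x) truth_language = "('c, 'x) language" +
  T_of :: "'c list \<Rightarrow> 'c list"
  var :: "'c list"
  corner :: "'c list \<Rightarrow> 'c list"
  gn :: "'c list \<Rightarrow> nat"

definition Tx :: "('c, 'x) truth_language \<Rightarrow> 'c list" where
  "Tx M = T_of M (var M)"

definition Tcorner :: "('c, 'x) truth_language \<Rightarrow> 'c list \<Rightarrow> 'c list" where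
  "Tcorner M P = T_of M (corner M P)"

definition Tnum :: "('c, 'x) truth_language \<Rightarrow> nat \<Rightarrow> 'c list" where
  "Tnum M n = T_of M (numeral_of M n)"

definition T_sentences :: "('c, 'x) truth_language \<Rightarrow> 'c list set" where
  "T_sentences M =
     range (Tnum M) \<union>
     {all_of M (Tx M), ex_of M (Tx M), all_of M (Tcorner M (Tx M)), ex_of M (Tcorner M (Tx M))} \<union>
     {all_of M (Tcorner M P) | P. P \<in> predicates M} \<union>
     {ex_of M (Tcorner M P) | P. P \<in> predicates M}"

primrec calL_stage :: "('c, 'x) truth_language \<Rightarrow> nat \<Rightarrow> 'c list set" where
  "calL_stage M 0 = sentences M \<union> T_sentences M"
| "calL_stage M (Suc n) = calL_stage M n \<union> compounds M (calL_stage M n)"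

definition calL :: "('c, 'x) truth_language \<Rightarrow> 'c list set" where
  "calL M = (\<Union>n. calL_stage M n)"

text \<open>
  In \<open>T_syntax\<close>, the formulas \<open>T(x)\<close> and \<open>T(\<lceil>P(x)\<rceil>)\<close> (including \<open>P = T\<close>) are the ones that get
  quantified; all conditions but the last two say that the resulting sentences and the sentences \<open>T(n)\<close>
  are pairwise distinct.
\<close>

definition T_formulas :: "('c, 'x) truth_language \<Rightarrow> 'c list set" where
  "T_formulas M = insert (Tx M) (Tcorner M ` insert (Tx M) (predicates M))"

definition T_syntax :: "('c, 'x) truth_language \<Rightarrow> bool" where
  "T_syntax M \<longleftrightarrow>
     inj (Tnum M) \<and>
     inj_on (Tcorner M) (insert (Tx M) (predicates M)) \<and>
     Tx M \<notin> Tcorner M ` insert (Tx M) (predicates M) \<and>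
     inj_on (all_of M) (T_formulas M) \<and> inj_on (ex_of M) (T_formulas M) \<and>
     range (Tnum M) \<inter> all_of M ` T_formulas M = {} \<and>
     range (Tnum M) \<inter> ex_of M ` T_formulas M = {} \<and>
     all_of M ` T_formulas M \<inter> ex_of M ` T_formulas M = {} \<and>
     Tx M \<notin> predicates M \<union> sentences M \<and>
     T_sentences M \<inter> sentences M = {}"

definition truth_extension :: "('c, 'x) truth_language \<Rightarrow> bool" where
  "truth_extension M \<longleftrightarrow>
     T_syntax M \<and>
     uniquely_readable M (calL M) \<and>
     \<comment> \<open>the new sentences are not built by a connective\<close>
     T_sentences M \<inter> compounds M (calL M) = {} \<and>
     \<comment> \<open>components of compound sentences of \<open>L\<close> are sentences of \<open>L\<close>\<close>
     (\<forall>A \<in> calL M. neg M A \<in> sentences M \<longrightarrow> A \<in> sentences M) \<and>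
     (\<forall>c. \<forall>A \<in> calL M. \<forall>B \<in> calL M.
        bin M c A B \<in> sentences M \<longrightarrow> A \<in> sentences M \<and> B \<in> sentences M) \<and>
     inj_on (gn M) (calL M)"

definition truth_predicate :: "('c, 'x) truth_language \<Rightarrow> 'c list \<Rightarrow> bool" where
  "truth_predicate M P \<longleftrightarrow>
     P \<in> predicates M \<and>
     (\<forall>A \<in> sentences M. num_val M (gn M A) \<in> dom_of M P \<and>
        true_in M (bin M Iff (inst M P (num_val M (gn M A))) A))"

definition D :: "('c, 'x) truth_language \<Rightarrow> nat set" where
  "D M = gn M ` calL M"

definition W :: "('c, 'x) truth_language \<Rightarrow> nat set" where
  "W M = {gn M A | A. A \<in> sentences M \<and> true_in M A}"

definition consistent_sets :: "('c, 'x) truth_language \<Rightarrow> nat set set" where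
  "consistent_sets M =
     {U. U \<subseteq> D M \<and> \<not> (\<exists>A \<in> calL M. gn M A \<in> U \<and> gn M (neg M A) \<in> U)}"

definition P1 :: "('c, 'x, 'm) language_scheme \<Rightarrow> 'c list set" where
  "P1 L = {P \<in> predicates L. \<forall>x \<in> dom_of L P. true_in L (inst L P x)}"

definition P2 :: "('c, 'x, 'm) language_scheme \<Rightarrow> 'c list set" where
  "P2 L = {P \<in> predicates L. \<forall>x \<in> dom_of L P. \<not> true_in L (inst L P x)}"

definition P3 :: "('c, 'x, 'm) language_scheme \<Rightarrow> 'c list set" where
  "P3 L = {P \<in> predicates L. (\<exists>x \<in> dom_of L P. true_in L (inst L P x)) \<and>
                              \<not> (\<forall>x \<in> dom_of L P. true_in L (inst L P x))}"

definition G0 :: "('c, 'x) truth_language \<Rightarrow> nat set \<Rightarrow> nat set" where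
  "G0 M U = (if U = {} then W M else
     W M \<union>
     {gn M (Tnum M (gn M A)) | A. A \<in> calL M \<and> gn M A \<in> U} \<union>
     {gn M (neg M (Tnum M (gn M A))) | A. A \<in> calL M \<and> gn M (neg M A) \<in> U} \<union>
     {gn M (neg M (all_of M (Tx M))), gn M (ex_of M (Tx M)),
      gn M (neg M (all_of M (Tcorner M (Tx M)))), gn M (ex_of M (Tcorner M (Tx M)))} \<union>
     {gn M (all_of M (Tcorner M P)) | P. P \<in> P1 M} \<union>
     {gn M (ex_of M (Tcorner M P)) | P. P \<in> P1 M} \<union>
     {gn M (neg M (all_of M (Tcorner M P))) | P. P \<in> P2 M} \<union>
     {gn M (neg M (ex_of M (Tcorner M P))) | P. P \<in> P2 M} \<union>
     {gn M (neg M (all_of M (Tcorner M P))) | P. P \<in> P3 M} \<union>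
     {gn M (ex_of M (Tcorner M P)) | P. P \<in> P3 M})"

definition G_step :: "('c, 'x) truth_language \<Rightarrow> nat set \<Rightarrow> nat set" where
  "G_step M V =
     (let S = calL M; H = (\<lambda>A. gn M A \<in> V); N = neg M; b = bin M in
     V \<union>
     {gn M (N (N A)) | A. A \<in> S \<and> H A} \<union>
     {gn M (b Disj A B) | A B. A \<in> S \<and> B \<in> S \<and> (H A \<or> H B)} \<union>
     {gn M (b Conj A B) | A B. A \<in> S \<and> B \<in> S \<and> H A \<and> H B} \<union>
     {gn M (b Imp A B) | A B. A \<in> S \<and> B \<in> S \<and> (H (N A) \<or> H B)} \<union>
     {gn M (b Iff A B) | A B. A \<in> S \<and> B \<in> S \<and> (H A \<and> H B \<or> H (N A) \<and> H (N B))} \<union>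
     {gn M (N (b Disj A B)) | A B. A \<in> S \<and> B \<in> S \<and> H (N A) \<and> H (N B)} \<union>
     {gn M (N (b Conj A B)) | A B. A \<in> S \<and> B \<in> S \<and> (H (N A) \<or> H (N B))} \<union>
     {gn M (N (b Imp A B)) | A B. A \<in> S \<and> B \<in> S \<and> H A \<and> H (N B)} \<union>
     {gn M (N (b Iff A B)) | A B. A \<in> S \<and> B \<in> S \<and> (H A \<and> H (N B) \<or> H (N A) \<and> H B)})"

primrec G_stage :: "('c, 'x) truth_language \<Rightarrow> nat set \<Rightarrow> nat \<Rightarrow> nat set" where
  "G_stage M U 0 = G0 M U"
| "G_stage M U (Suc n) = G_step M (G_stage M U n)"

definition G :: "('c, 'x) truth_language \<Rightarrow> nat set \<Rightarrow> nat set" where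
  "G M U = (\<Union>n. G_stage M U n)"

definition G_sequence ::
    "('c, 'x) truth_language \<Rightarrow> 'i ordinal \<Rightarrow> ('i ordinal \<Rightarrow> nat set) \<Rightarrow> bool" where
  "G_sequence M \<alpha> U \<longleftrightarrow>
     (\<forall>\<mu> < \<alpha>. U \<mu> \<in> consistent_sets M) \<and>
     (\<forall>\<mu> \<nu>. \<mu> < \<nu> \<and> \<nu> < \<alpha> \<longrightarrow> U \<mu> \<subset> U \<nu>) \<and>
     (0 < \<alpha> \<longrightarrow> U 0 = W M) \<and>
     (\<forall>\<mu>. 0 < \<mu> \<and> \<mu> < \<alpha> \<longrightarrow> U \<mu> = (\<Union>\<kappa> \<in> {..<\<mu>}. G M (U \<kappa>)))"

definition union_of_G_sequences ::
    "('c, 'x) truth_language \<Rightarrow> ('i ordinal \<times> nat set) set" where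
  "union_of_G_sequences M = \<Union> {seq_graph \<alpha> U | \<alpha> U. G_sequence M \<alpha> U}"

end

theory Submission
  imports Defs
begin

text \<open>
  \<open>G\<close> is monotone. It also preserves consistency: by unique readability each rule of the
  construction of \<open>G(U)\<close> can be inverted (for the sentences of \<open>L\<close> because they are classically
  interpreted), so a contradiction in \<open>G(U)\<close> descends along the structure of sentences to the atomic
  sentences, where it would contradict the consistency of \<open>U\<close>. By monotonicity the iteration of
  \<open>G\<close> from \<open>W\<close> is an increasing chain of consistent sets, and each of the sequences is an initial
  segment of it. The iteration adds a new number as long as it is not at a fixed point, so the least
  fixed point is reached after countably many steps, hence within the ordinals of an infinite type.
\<close>

section \<open>Ordinals\<close>

lemma rep_abs_ordinal: "Well_order r \<Longrightarrow> (rep_ordinal (abs_ordinal r), r) \<in> ordIso"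
  by (rule Quotient3_rep_abs[OF Quotient3_ordinal]) (rule ordIso_reflexive)

lemma abs_ordinal_eqI:
  assumes "(rep_ordinal a, r) \<in> ordIso"
  shows "abs_ordinal r = a"
proof -
  have "Well_order r" using assms by (auto simp: ordIso_def)
  then have "(rep_ordinal (abs_ordinal r), rep_ordinal a) \<in> ordIso"
    using rep_abs_ordinal assms ordIso_symmetric ordIso_transitive by blast
  then show ?thesis by (simp add: rep_ordinal_eq)
qed

lemma abs_ordinal_less:
  assumes "(r, s) \<in> ordLess"
  shows "abs_ordinal r < abs_ordinal s"
proof -
  have "Well_order r" "Well_order s" using assms by (auto simp: ordLess_def)
  then show ?thesis
    unfolding less_ordinal_def
    by (meson assms rep_abs_ordinal ordIso_ordLess_trans ordLess_ordIso_trans ordIso_symmetric)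
qed

text \<open>Burali-Forti: an injection would transport the order of all the ordinals to a well-order
  on \<open>'i\<close>, which would be longer than each of its own initial segments \<open>{b. b < a}\<close>.\<close>

lemma no_inj_ordinal: "\<not> inj (f :: 'i ordinal \<Rightarrow> 'i)"
proof
  assume f: "inj f"
  define r where "r = {(f a, f b) | a b. a \<le> b}"
  have Fr: "Field r = range f"
    by (auto simp: r_def Field_def)
  have r_iff: "(f a, f b) \<in> r \<longleftrightarrow> a \<le> b" for a b
    using f by (auto simp: r_def inj_eq)
  have "wf (r - Id)"
  proof (rule wf_subset)
    show "wf (inv_image {(a :: 'i ordinal, b). a < b} (inv f))"
      by (rule wf_inv_image) (rule wf)
    show "r - Id \<subseteq> inv_image {(a, b). a < b} (inv f)"
      using f by (auto simp: r_def order_le_less)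
  qed
  moreover have "Linear_order r"
    unfolding order_on_defs Fr
    by (auto simp: r_def refl_on_def trans_def antisym_def total_on_def inj_eq[OF f]
        dest: order_trans)
  ultimately have wo: "Well_order r"
    by (simp add: well_order_on_def)
  have less: "(rep_ordinal b, r) \<in> ordLess" for b :: "'i ordinal"
  proof -
    let ?s = "rep_ordinal b"
    \<comment> \<open>\<open>h x\<close> is the order type of the initial segment strictly below
      \<open>x\<close>. It is the isomorphism of \<open>?s\<close> onto the ordinals below
      \<open>b\<close>, and \<open>f\<close> carries it into \<open>r\<close>.\<close>
    define h where "h x = abs_ordinal (Restr ?s (underS ?s x))" for x
    have wos: "Well_order ?s" by (rule Well_order_rep_ordinal)
    interpret s: wo_rel ?s by (simp add: wo_rel_def wos)
    have of: "ofilter ?s (underS ?s x)" for x by (rule s.underS_ofilter)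
    have mono: "h x < h y" if "(x, y) \<in> ?s" "x \<noteq> y" for x y
      unfolding h_def
    proof (rule abs_ordinal_less)
      have "x \<in> underS ?s y" "x \<notin> underS ?s x" "underS ?s x \<subseteq> underS ?s y"
        using that s.ANTISYM s.TRANS
        by (auto simp: underS_def dest: antisymD transD)
      then show "(Restr ?s (underS ?s x), Restr ?s (underS ?s y)) \<in> ordLess"
        using ofilter_subset_ordLess[OF wos of of] by blast
    qed
    have h_less: "h x < b" if "x \<in> Field ?s" for x
    proof -
      have "abs_ordinal (Restr ?s (underS ?s x)) < abs_ordinal ?s"
        by (rule abs_ordinal_less) (rule underS_Restr_ordLess[OF wos], use that in blast)
      moreover have "abs_ordinal ?s = b"
        by (rule abs_ordinal_eqI) (rule ordIso_reflexive[OF wos])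
      ultimately show ?thesis by (simp add: h_def)
    qed
    have h_surj: "c \<in> h ` Field ?s" if "c < b" for c
    proof -
      have "(rep_ordinal c, ?s) \<in> ordLess" using that by (simp add: less_ordinal_def)
      then obtain x where "x \<in> Field ?s" "(rep_ordinal c, Restr ?s (underS ?s x)) \<in> ordIso"
        using ordLess_iff_ordIso_Restr[OF wos Well_order_rep_ordinal] by blast
      then show ?thesis using abs_ordinal_eqI unfolding h_def by blast
    qed
    have img: "h ` Field ?s = {c. c < b}"
      using h_less h_surj by auto
    have fimg: "(\<lambda>x. f (h x)) ` Field ?s = f ` {c. c < b}"
      unfolding img[symmetric] by auto
    have cmp: "compat ?s r (\<lambda>x. f (h x))"
      unfolding compat_def by (auto simp: r_iff) (metis mono order_le_less)
    have inj: "inj_on (\<lambda>x. f (h x)) (Field ?s)"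
    proof (rule inj_onI)
      fix x y assume xy: "x \<in> Field ?s" "y \<in> Field ?s" "f (h x) = f (h y)"
      show "x = y"
      proof (rule ccontr)
        assume "x \<noteq> y"
        moreover from this have "(x, y) \<in> ?s \<or> (y, x) \<in> ?s"
          using s.TOTAL xy by (auto simp: total_on_def)
        ultimately have "h x < h y \<or> h y < h x" using mono by blast
        then show False using xy(3) f by (auto simp: inj_eq)
      qed
    qed
    \<comment> \<open>The image is closed downwards in \<open>r\<close>, and it is proper because it
      omits \<open>f b\<close>. This makes the embedding of \<open>?s\<close> into \<open>r\<close>
      strict.\<close>
    have "ofilter r (f ` {c. c < b})"
      unfolding ofilter_def under_def Fr
      by (auto simp: r_def inj_eq[OF f])
    then have "embed ?s r (\<lambda>x. f (h x))"
      using embed_iff_compat_inj_on_ofilter[OF wos wo] cmp inj fimg by simp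
    moreover have "(\<lambda>x. f (h x)) ` Field ?s \<subset> Field r"
      unfolding fimg Fr using inj_image_eq_iff[OF f, of "{c. c < b}" UNIV] by blast
    ultimately have "embedS ?s r (\<lambda>x. f (h x))"
      using embedS_iff[OF wos] by blast
    then show ?thesis using wo wos by (auto simp: ordLess_def)
  qed
  \<comment> \<open>The order type of \<open>r\<close> is itself an ordinal of the type, so its
    representative would be both isomorphic to \<open>r\<close> and shorter than
    \<open>r\<close>.\<close>
  show False
    using less[of "abs_ordinal r"] rep_abs_ordinal[OF wo] not_ordLess_ordIso by blast
qed

text \<open>Countably many ordinals would inject into \<open>nat\<close>, hence into the infinite
  type \<open>'i\<close>. This bound guarantees that the type is long enough for the iteration to
  become stationary.\<close>

lemma uncountable_ordinal: "uncountable (UNIV :: 'i::infinite ordinal set)"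
proof
  assume "countable (UNIV :: 'i ordinal set)"
  then obtain f :: "'i ordinal \<Rightarrow> nat" where f: "inj f" by (rule countableE)
  obtain g :: "nat \<Rightarrow> 'i" where "inj g"
    using infinite_countable_subset[OF infinite_UNIV] by blast
  then have "inj (g \<circ> f)" using f by (simp add: inj_compose)
  then show False using no_inj_ordinal by blast
qed

section \<open>Sentences with the truth predicate\<close>

locale truth_extension_of_interpreted =
  fixes M :: "('c, 'x) truth_language"
  assumes interpreted: "fully_interpreted M"
    and extension: "truth_extension M"
begin

lemma lang: "language M"
  using interpreted by (simp add: fully_interpreted_def)

lemma true_neg: "A \<in> sentences M \<Longrightarrow> true_in M (neg M A) \<longleftrightarrow> \<not> true_in M A"
  using interpreted by (simp add: fully_interpreted_def)

lemma true_bin: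
  assumes "A \<in> sentences M" "B \<in> sentences M"
  shows "true_in M (bin M Disj A B) \<longleftrightarrow> true_in M A \<or> true_in M B"
    and "true_in M (bin M Conj A B) \<longleftrightarrow> true_in M A \<and> true_in M B"
    and "true_in M (bin M Imp A B) \<longleftrightarrow> (true_in M A \<longrightarrow> true_in M B)"
    and "true_in M (bin M Iff A B) \<longleftrightarrow> (true_in M A \<longleftrightarrow> true_in M B)"
  using interpreted assms by (simp_all add: fully_interpreted_def)

lemma sentences_neg: "A \<in> sentences M \<Longrightarrow> neg M A \<in> sentences M"
  using lang by (simp add: language_def)

lemma sentences_bin:
  "A \<in> sentences M \<Longrightarrow> B \<in> sentences M \<Longrightarrow> bin M c A B \<in> sentences M"
  using lang by (simp add: language_def)

lemma stage_mono: "m \<le> n \<Longrightarrow> calL_stage M m \<subseteq> calL_stage M n"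
  by (rule lift_Suc_mono_le) auto

lemma sentences_calL: "A \<in> sentences M \<Longrightarrow> A \<in> calL M"
  unfolding calL_def by (rule UN_I[of 0]) auto

lemma T_sentences_calL: "A \<in> T_sentences M \<Longrightarrow> A \<in> calL M"
  unfolding calL_def by (rule UN_I[of 0]) auto

lemma calL_neg [simp]:
  assumes "A \<in> calL M"
  shows "neg M A \<in> calL M"
proof -
  obtain n where "A \<in> calL_stage M n" using assms by (auto simp: calL_def)
  then have "neg M A \<in> calL_stage M (Suc n)" by (auto simp: compounds_def)
  then show ?thesis unfolding calL_def by blast
qed

lemma calL_bin [simp]:
  assumes "A \<in> calL M" "B \<in> calL M"
  shows "bin M c A B \<in> calL M"
proof -
  obtain m n where "A \<in> calL_stage M m" "B \<in> calL_stage M n"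
    using assms by (auto simp: calL_def)
  then have "A \<in> calL_stage M (max m n)" "B \<in> calL_stage M (max m n)"
    using stage_mono[of m "max m n"] stage_mono[of n "max m n"] by auto
  then have "bin M c A B \<in> calL_stage M (Suc (max m n))"
    by (auto simp: compounds_def)
  then show ?thesis unfolding calL_def by blast
qed

text \<open>Induction on the stage at which a sentence appears, repackaged as induction on its
  structure. It drives the proof that \<open>G\<close> preserves consistency.\<close>

lemma calL_induct [consumes 1, case_names sentence T_sentence neg bin]:
  assumes "A \<in> calL M"
    and "\<And>A. A \<in> sentences M \<Longrightarrow> Q A"
    and "\<And>A. A \<in> T_sentences M \<Longrightarrow> Q A"
    and "\<And>A. A \<in> calL M \<Longrightarrow> Q A \<Longrightarrow> Q (neg M A)"
    and "\<And>c A B. A \<in> calL M \<Longrightarrow> B \<in> calL M \<Longrightarrow> Q A \<Longrightarrow> Q B \<Longrightarrow> Q (bin M c A B)"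
  shows "Q A"
proof -
  have "\<forall>A \<in> calL_stage M n. Q A" for n
  proof (induction n)
    case 0
    show ?case using assms(2,3) by auto
  next
    case (Suc n)
    have "calL_stage M n \<subseteq> calL M" by (auto simp: calL_def)
    then show ?case
      using Suc assms(4,5) by (auto simp: compounds_def subset_iff)
  qed
  then show ?thesis using assms(1) by (auto simp: calL_def)
qed

section \<open>Unique readability, and how \<open>L\<close> sits inside \<open>calL\<close>\<close>

lemma readable: "uniquely_readable M (calL M)"
  using extension by (simp add: truth_extension_def)

lemma gn_eq [simp]: "A \<in> calL M \<Longrightarrow> B \<in> calL M \<Longrightarrow> gn M A = gn M B \<longleftrightarrow> A = B"
  using extension unfolding truth_extension_def by (blast dest: inj_onD)

lemma neg_eq [simp]: "A \<in> calL M \<Longrightarrow> B \<in> calL M \<Longrightarrow> neg M A = neg M B \<longleftrightarrow> A = B"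
  using readable unfolding uniquely_readable_def by (blast dest: inj_onD)

lemma bin_eq [simp]:
  assumes "A \<in> calL M" "B \<in> calL M" "A' \<in> calL M" "B' \<in> calL M"
  shows "bin M c A B = bin M c' A' B' \<longleftrightarrow> c = c' \<and> A = A' \<and> B = B'"
  using readable assms unfolding uniquely_readable_def by blast

lemma neg_neq_bin [simp]:
  assumes "A \<in> calL M" "B \<in> calL M" "C \<in> calL M"
  shows "neg M C \<noteq> bin M c A B" and "bin M c A B \<noteq> neg M C"
  using readable assms unfolding uniquely_readable_def by metis+

lemma T_sentence_not_compound:
  assumes "A \<in> calL M" "B \<in> calL M"
  shows "neg M A \<notin> T_sentences M" and "bin M c A B \<notin> T_sentences M"
proof -
  have "T_sentences M \<inter> compounds M (calL M) = {}"
    using extension by (simp add: truth_extension_def)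
  moreover have "neg M A \<in> compounds M (calL M)" "bin M c A B \<in> compounds M (calL M)"
    using assms unfolding compounds_def by blast+
  ultimately show "neg M A \<notin> T_sentences M" "bin M c A B \<notin> T_sentences M" by blast+
qed

lemma T_sentence_not_sentence: "A \<in> T_sentences M \<Longrightarrow> A \<notin> sentences M"
  using extension unfolding truth_extension_def T_syntax_def by blast

lemma sentence_negD: "neg M A \<in> sentences M \<Longrightarrow> A \<in> calL M \<Longrightarrow> A \<in> sentences M"
  using extension unfolding truth_extension_def by blast

lemma sentence_binD:
  assumes "bin M c A B \<in> sentences M" "A \<in> calL M" "B \<in> calL M"
  shows "A \<in> sentences M" and "B \<in> sentences M"
  using extension[unfolded truth_extension_def, THEN conjunct2, THEN conjunct2,
      THEN conjunct2, THEN conjunct2, THEN conjunct1] assms by blast+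

lemma sentence_neg_iff: "A \<in> calL M \<Longrightarrow> neg M A \<in> sentences M \<longleftrightarrow> A \<in> sentences M"
  using sentence_negD sentences_neg by blast

lemma sentence_bin_iff:
  assumes "A \<in> calL M" "B \<in> calL M"
  shows "bin M c A B \<in> sentences M \<longleftrightarrow> A \<in> sentences M \<and> B \<in> sentences M"
  using assms sentence_binD sentences_bin by blast

lemma W_iff: "A \<in> calL M \<Longrightarrow> gn M A \<in> W M \<longleftrightarrow> A \<in> sentences M \<and> true_in M A"
  using sentences_calL by (auto simp: W_def)

lemma W_subset_D: "W M \<subseteq> D M"
  using sentences_calL by (auto simp: W_def D_def)

section \<open>The literals of the truth predicate\<close>

text \<open>\<open>T_true U\<close> collects the sentences about truth that \<open>G0\<close> adds
  outright, \<open>T_false U\<close> those whose negations it adds. Consistency of these literals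
  thereby becomes disjointness of two sets.\<close>

definition T_true :: "nat set \<Rightarrow> 'c list set" where
  "T_true U =
     {Tnum M (gn M A) | A. A \<in> calL M \<and> gn M A \<in> U} \<union>
     all_of M ` Tcorner M ` P1 M \<union>
     ex_of M ` ({Tx M, Tcorner M (Tx M)} \<union> Tcorner M ` (P1 M \<union> P3 M))"

definition T_false :: "nat set \<Rightarrow> 'c list set" where
  "T_false U =
     {Tnum M (gn M A) | A. A \<in> calL M \<and> gn M (neg M A) \<in> U} \<union>
     all_of M ` ({Tx M, Tcorner M (Tx M)} \<union> Tcorner M ` (P2 M \<union> P3 M)) \<union>
     ex_of M ` Tcorner M ` P2 M"

lemma G0_eq: "G0 M U = (if U = {} then W M else W M \<union> gn M ` (T_true U \<union> neg M ` T_false U))"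
proof -
  \<comment> \<open>Nested images in place of comprehensions let \<open>gn\<close> and
    \<open>neg\<close> be factored out of the unions in \<open>G0\<close>.\<close>
  have "{f (g A) | A. A \<in> calL M \<and> Q A} = f ` {g A | A. A \<in> calL M \<and> Q A}" for f g Q
    by blast
  then show ?thesis
    unfolding G0_def T_true_def T_false_def
    by (simp add: setcompr_eq_image image_image image_Un Un_ac insert_commute)
qed

lemma P_subset: "P1 M \<subseteq> predicates M" "P2 M \<subseteq> predicates M" "P3 M \<subseteq> predicates M"
  by (auto simp: P1_def P2_def P3_def)

text \<open>That no predicate is in both \<open>P1\<close> and \<open>P2\<close> rests on domains
  being nonempty.\<close>

lemma P_disjoint: "P1 M \<inter> P2 M = {}" "P1 M \<inter> P3 M = {}" "P2 M \<inter> P3 M = {}"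
  using lang by (auto simp: P1_def P2_def P3_def language_def)

lemma T_true_T_sentences: "T_true U \<subseteq> T_sentences M"
  using P_subset unfolding T_true_def T_sentences_def by blast

lemma T_false_T_sentences: "T_false U \<subseteq> T_sentences M"
  using P_subset unfolding T_false_def T_sentences_def by blast

text \<open>The three shapes \<open>T(n)\<close>, universal and existential are syntactically
  disjoint, so a clash can occur only within one shape. For numerals the consistency of
  \<open>U\<close> forbids it; for quantified sentences, injectivity of the syntax reduces it to
  disjointness of the classes of predicates.\<close>

lemma T_true_T_false:
  assumes U: "U \<in> consistent_sets M"
  shows "T_true U \<inter> T_false U = {}"
proof -
  let ?I = "insert (Tx M) (predicates M)"
  note syn = extension[unfolded truth_extension_def T_syntax_def, THEN conjunct1]
  have inj: "inj (Tnum M)" "inj_on (Tcorner M) ?I"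
    "inj_on (all_of M) (T_formulas M)" "inj_on (ex_of M) (T_formulas M)"
    and Tx: "Tx M \<notin> Tcorner M ` ?I" "Tx M \<notin> predicates M \<union> sentences M"
    and dis: "range (Tnum M) \<inter> all_of M ` T_formulas M = {}"
      "range (Tnum M) \<inter> ex_of M ` T_formulas M = {}"
      "all_of M ` T_formulas M \<inter> ex_of M ` T_formulas M = {}"
    using syn by - (elim conjE, assumption)+
  \<comment> \<open>The numeral parts of \<open>T_true U\<close> and \<open>T_false U\<close>. A
    common element would, as \<open>Tnum\<close> and \<open>gn\<close> are injective, give a
    sentence lying in \<open>U\<close> together with its negation.\<close>
  define N where "N = {Tnum M (gn M A) | A. A \<in> calL M \<and> gn M A \<in> U}"
  define N' where "N' = {Tnum M (gn M A) | A. A \<in> calL M \<and> gn M (neg M A) \<in> U}"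
  have N: "N \<inter> N' = {}" "N \<subseteq> range (Tnum M)" "N' \<subseteq> range (Tnum M)"
    using U inj(1) unfolding N_def N'_def consistent_sets_def by (auto simp: inj_eq)
  define X where "X = {Tx M, Tcorner M (Tx M)}"
  have sub: "X \<subseteq> T_formulas M" "Q \<subseteq> predicates M \<Longrightarrow> Tcorner M ` Q \<subseteq> T_formulas M" for Q
    unfolding X_def T_formulas_def by auto
  have image: "f ` A \<inter> f ` B = {}"
    if "inj_on f C" "A \<subseteq> C" "B \<subseteq> C" "A \<inter> B = {}"
    for f :: "'c list \<Rightarrow> 'c list" and A B C
    using inj_on_image_Int[OF that(1-3)] that(4) by simp
  have X: "X \<inter> Tcorner M ` Q = {}" if "Q \<subseteq> predicates M" for Q
    using that Tx inj(2) unfolding X_def by (auto simp: inj_on_def)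
  have cor: "Tcorner M ` P1 M \<inter> Tcorner M ` (P2 M \<union> P3 M) = {}"
    "Tcorner M ` (P1 M \<union> P3 M) \<inter> Tcorner M ` P2 M = {}"
    by (rule image[OF inj(2)]; use P_subset P_disjoint in blast)+
  have all: "all_of M ` Tcorner M ` P1 M \<inter> all_of M ` (X \<union> Tcorner M ` (P2 M \<union> P3 M)) = {}"
    by (rule image[OF inj(3)])
      (use sub P_subset X[of "P1 M"] cor(1) in \<open>simp_all add: Int_Un_distrib Int_commute\<close>)
  have ex: "ex_of M ` (X \<union> Tcorner M ` (P1 M \<union> P3 M)) \<inter> ex_of M ` Tcorner M ` P2 M = {}"
    by (rule image[OF inj(4)])
      (use sub P_subset X[of "P2 M"] cor(2) in \<open>simp_all add: Int_Un_distrib2\<close>)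
  have "T_true U = N \<union> all_of M ` Tcorner M ` P1 M \<union> ex_of M ` (X \<union> Tcorner M ` (P1 M \<union> P3 M))"
    "T_false U = N' \<union> all_of M ` (X \<union> Tcorner M ` (P2 M \<union> P3 M)) \<union> ex_of M ` Tcorner M ` P2 M"
    by (auto simp: T_true_def T_false_def N_def N'_def X_def)
  moreover have "all_of M ` Tcorner M ` P1 M \<subseteq> all_of M ` T_formulas M"
    "ex_of M ` (X \<union> Tcorner M ` (P1 M \<union> P3 M)) \<subseteq> ex_of M ` T_formulas M"
    "all_of M ` (X \<union> Tcorner M ` (P2 M \<union> P3 M)) \<subseteq> all_of M ` T_formulas M"
    "ex_of M ` Tcorner M ` P2 M \<subseteq> ex_of M ` T_formulas M"
    using sub P_subset by (intro image_mono; simp)+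
  \<comment> \<open>The bare set algebra: \<open>r\<close>, \<open>s\<close>, \<open>t\<close> stand
    for the three disjoint shapes, and each pair of parts is disjoint within its shape.\<close>
  moreover have "(n \<union> a \<union> e) \<inter> (n' \<union> a' \<union> e') = {}"
    if "n \<inter> n' = {}" "n \<subseteq> r" "n' \<subseteq> r" "a \<inter> a' = {}" "a \<subseteq> s" "a' \<subseteq> s"
      "e \<inter> e' = {}" "e \<subseteq> t" "e' \<subseteq> t" "r \<inter> s = {}" "r \<inter> t = {}" "s \<inter> t = {}"
    for n n' a a' e e' r s t :: "'c list set"
    using that by blast
  note this[OF N all _ _ ex _ _ dis]
  ultimately show ?thesis
    by simp
qed

section \<open>The operator \<open>G\<close> preserves consistency\<close>

text \<open>The conclusions of the rules as sentences rather than as Goedel numbers, so that unique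
  readability can be applied to them directly.\<close>

definition derived :: "nat set \<Rightarrow> 'c list set" where
  "derived V =
     (let S = calL M; H = (\<lambda>A. gn M A \<in> V); N = neg M; b = bin M in
     {N (N A) | A. A \<in> S \<and> H A} \<union>
     {b Disj A B | A B. A \<in> S \<and> B \<in> S \<and> (H A \<or> H B)} \<union>
     {b Conj A B | A B. A \<in> S \<and> B \<in> S \<and> H A \<and> H B} \<union>
     {b Imp A B | A B. A \<in> S \<and> B \<in> S \<and> (H (N A) \<or> H B)} \<union>
     {b Iff A B | A B. A \<in> S \<and> B \<in> S \<and> (H A \<and> H B \<or> H (N A) \<and> H (N B))} \<union>
     {N (b Disj A B) | A B. A \<in> S \<and> B \<in> S \<and> H (N A) \<and> H (N B)} \<union>
     {N (b Conj A B) | A B. A \<in> S \<and> B \<in> S \<and> (H (N A) \<or> H (N B))} \<union>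
     {N (b Imp A B) | A B. A \<in> S \<and> B \<in> S \<and> H A \<and> H (N B)} \<union>
     {N (b Iff A B) | A B. A \<in> S \<and> B \<in> S \<and> (H A \<and> H (N B) \<or> H (N A) \<and> H B)})"

lemma G_step_eq: "G_step M V = V \<union> gn M ` derived V"
proof -
  have "gn M ` {f A | A. Q A} = {gn M (f A) | A. Q A}" for f :: "'c list \<Rightarrow> _" and Q
    by blast
  moreover have "gn M ` {f A B | A B. Q A B} = {gn M (f A B) | A B. Q A B}"
    for f :: "'c list \<Rightarrow> 'c list \<Rightarrow> _" and Q
    by blast
  ultimately show ?thesis
    by (simp only: G_step_def derived_def Let_def image_Un Un_assoc)
qed

section \<open>Monotonicity and range of \<open>G\<close>\<close>

lemma derived_mono: "V \<subseteq> V' \<Longrightarrow> derived V \<subseteq> derived V'"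
  unfolding derived_def Let_def by (intro Un_mono; blast)

lemma derived_calL: "derived V \<subseteq> calL M"
  by (auto simp: derived_def Let_def)

lemma G_step_iff:
  assumes "X \<in> calL M"
  shows "gn M X \<in> G_step M V \<longleftrightarrow> gn M X \<in> V \<or> X \<in> derived V"
proof -
  have "inj_on (gn M) (calL M)" by (auto simp: inj_on_def)
  then show ?thesis
    unfolding G_step_eq using inj_on_image_mem_iff[OF _ assms derived_calL] by blast
qed

text \<open>\<open>U\<close> occurs only positively in the literals and in the rules. The
  exceptional value at the empty set does no harm, since \<open>W M\<close> is contained in every
  \<open>G0 M U'\<close>.\<close>

lemma G_stage_mono:
  assumes "U \<subseteq> U'"
  shows "G_stage M U n \<subseteq> G_stage M U' n"
proof (induction n)
  case 0
  have "T_true U \<subseteq> T_true U'" "T_false U \<subseteq> T_false U'"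
    using assms unfolding T_true_def T_false_def by blast+
  then show ?case using assms by (auto simp: G0_eq)
next
  case (Suc n)
  then show ?case using derived_mono[OF Suc] by (auto simp: G_step_eq)
qed

lemma G_mono: "U \<subseteq> U' \<Longrightarrow> G M U \<subseteq> G M U'"
  unfolding G_def by (intro UN_mono G_stage_mono order_refl)

lemma G0_subset_G: "G0 M U \<subseteq> G M U"
  unfolding G_def by (metis G_stage.simps(1) UNIV_I UN_upper)

lemma W_subset_G: "W M \<subseteq> G M U"
  using G0_subset_G[of U] by (auto simp: G0_eq split: if_splits)

lemma G_stage_subset_D: "G_stage M U n \<subseteq> D M"
proof (induction n)
  case 0
  have "T_true U \<subseteq> calL M" "neg M ` T_false U \<subseteq> calL M"
    using T_true_T_sentences T_false_T_sentences T_sentences_calL calL_neg by blast+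
  then show ?case using W_subset_D by (auto simp: G0_eq D_def)
next
  case (Suc n)
  then show ?case using derived_calL by (auto simp: G_step_eq D_def)
qed

lemma G_subset_D: "G M U \<subseteq> D M"
  using G_stage_subset_D by (auto simp: G_def)

text \<open>The rule that first produces a sentence has its premises at an earlier stage, hence in
  \<open>G M U\<close>. Rules can thus be inverted inside \<open>G M U\<close> without stage
  indices.\<close>

lemma G_unfold:
  assumes "gn M X \<in> G M U" "X \<in> calL M"
  shows "gn M X \<in> G0 M U \<or> X \<in> derived (G M U)"
proof -
  have "gn M X \<in> G_stage M U n \<Longrightarrow> ?thesis" for n
  proof (induction n)
    case (Suc n)
    have "G_stage M U n \<subseteq> G M U" by (auto simp: G_def)
    then show ?case
      using Suc derived_mono[of "G_stage M U n" "G M U"] assms(2) by (auto simp: G_step_iff)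
  qed simp
  then show ?thesis using assms(1) by (auto simp: G_def)
qed

section \<open>Sentences of \<open>L\<close> inside \<open>G M U\<close>\<close>

lemma G0_cases:
  assumes "gn M X \<in> G0 M U" "X \<in> calL M"
  obtains "X \<in> sentences M" "true_in M X"
  | "U \<noteq> {}" "X \<in> T_true U"
  | Y where "U \<noteq> {}" "X = neg M Y" "Y \<in> T_false U"
proof -
  have "Y \<in> calL M" if "Y \<in> T_true U \<union> T_false U" for Y
    using that T_true_T_sentences T_false_T_sentences T_sentences_calL by blast
  then show ?thesis
    using assms that by (auto simp: G0_eq W_iff split: if_splits)
qed

text \<open>The rules are sound for classical truth. Components of a sentence of \<open>L\<close>
  lie in \<open>L\<close>, so the assumption on \<open>V\<close> applies to the premises.\<close>

lemma derived_true:
  assumes "\<And>A. gn M A \<in> V \<Longrightarrow> A \<in> sentences M \<Longrightarrow> true_in M A"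
    and "X \<in> derived V" "X \<in> sentences M"
  shows "true_in M X"
  using assms(2,3) unfolding derived_def Let_def
  by (elim UnE CollectE exE conjE;
      auto simp: sentence_neg_iff sentence_bin_iff true_neg true_bin dest!: assms(1))

text \<open>The literals added at stage 0 lie outside \<open>L\<close>, and the rules are sound on
  \<open>L\<close>, so \<open>G\<close> stays conservative over \<open>L\<close>. Inversion needs
  this for compounds that enter through \<open>W M\<close> instead of through a rule.\<close>

lemma G_sentence:
  assumes "gn M X \<in> G M U" "X \<in> sentences M"
  shows "true_in M X"
proof -
  have "gn M X \<in> G_stage M U n \<Longrightarrow> X \<in> sentences M \<Longrightarrow> true_in M X" for n X
  proof (induction n arbitrary: X)
    case 0
    have "X \<in> calL M" using 0 sentences_calL by blast
    with 0(1)[simplified] show ?case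
    proof (cases rule: G0_cases)
      case 2
      then show ?thesis using 0 T_true_T_sentences T_sentence_not_sentence by blast
    next
      case (3 Y)
      then show ?thesis
        using 0 T_false_T_sentences T_sentence_not_sentence sentence_negD T_sentences_calL by blast
    qed
  next
    case (Suc n)
    have "X \<in> calL M" using Suc.prems sentences_calL by blast
    then show ?case
      using Suc derived_true[of "G_stage M U n" X] by (auto simp: G_step_iff)
  qed
  then show ?thesis using assms by (auto simp: G_def)
qed

lemma G_sentence_iff:
  assumes "A \<in> sentences M"
  shows "gn M A \<in> G M U \<longleftrightarrow> true_in M A"
proof
  assume "true_in M A"
  then have "gn M A \<in> W M" using W_iff assms sentences_calL by blast
  then show "gn M A \<in> G M U" using W_subset_G by blast
qed (use G_sentence assms in blast)

text \<open>The added literals are sentences about truth or single negations of them, and such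
  sentences are not compounds. A formula of one of these shapes can therefore come only from
  \<open>W M\<close>.\<close>

lemma G0_compound:
  assumes "gn M X \<in> G0 M U" "X \<in> calL M"
    and "X = neg M (neg M A) \<or> X = bin M c A B \<or> X = neg M (bin M c A B)"
    and "A \<in> calL M" "B \<in> calL M"
  shows "X \<in> sentences M"
  using assms(1,2)
proof (cases rule: G0_cases)
  case 2
  then show ?thesis
    using assms T_true_T_sentences T_sentence_not_compound by (metis calL_neg calL_bin subsetD)
next
  case (3 Y)
  have "Y \<in> T_sentences M" using 3 T_false_T_sentences by blast
  moreover have "Y \<in> calL M" using calculation T_sentences_calL by blast
  ultimately show ?thesis
    using assms 3(2) T_sentence_not_compound by auto
qed

text \<open>As in the next two lemmas there are two cases: for a sentence of \<open>L\<close>,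
  membership is truth and the truth tables decide; otherwise a rule produced it, and unique
  readability leaves just one rule.\<close>

lemma G_neg_neg:
  assumes "gn M (neg M (neg M A)) \<in> G M U" "A \<in> calL M"
  shows "gn M A \<in> G M U"
proof -
  \<comment> \<open>The connective \<open>Disj\<close> and the second \<open>A\<close> merely fill
    the arguments of \<open>G0_compound\<close> for binary compounds.\<close>
  have "neg M (neg M A) \<in> sentences M \<or> neg M (neg M A) \<in> derived (G M U)"
    using G_unfold[OF assms(1)] G0_compound[of "neg M (neg M A)" U A Disj A] assms(2) by auto
  then show ?thesis
  proof
    assume s: "neg M (neg M A) \<in> sentences M"
    then have "neg M A \<in> sentences M" using assms(2) sentence_negD by simp
    moreover from this have "A \<in> sentences M" using assms(2) sentence_negD by blast
    ultimately show ?thesis using assms(1) s by (simp add: G_sentence_iff true_neg)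
  qed (use assms(2) in \<open>auto simp: derived_def Let_def\<close>)
qed

lemma G_bin:
  assumes "gn M (bin M c A B) \<in> G M U" "A \<in> calL M" "B \<in> calL M"
  shows "case c of
      Disj \<Rightarrow> gn M A \<in> G M U \<or> gn M B \<in> G M U
    | Conj \<Rightarrow> gn M A \<in> G M U \<and> gn M B \<in> G M U
    | Imp \<Rightarrow> gn M (neg M A) \<in> G M U \<or> gn M B \<in> G M U
    | Iff \<Rightarrow> gn M A \<in> G M U \<and> gn M B \<in> G M U \<or>
        gn M (neg M A) \<in> G M U \<and> gn M (neg M B) \<in> G M U"
proof -
  have "bin M c A B \<in> sentences M \<or> bin M c A B \<in> derived (G M U)"
    using G_unfold[OF assms(1)] G0_compound[of "bin M c A B" U A c B] assms(2,3) by auto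
  then show ?thesis
  proof
    assume s: "bin M c A B \<in> sentences M"
    then show ?thesis using assms(1) sentence_binD[OF s assms(2,3)]
      by (auto simp: G_sentence_iff true_neg true_bin sentences_neg split: connective.split)
  qed (use assms(2,3) in \<open>auto simp: derived_def Let_def\<close>)
qed

lemma G_neg_bin:
  assumes "gn M (neg M (bin M c A B)) \<in> G M U" "A \<in> calL M" "B \<in> calL M"
  shows "case c of
      Disj \<Rightarrow> gn M (neg M A) \<in> G M U \<and> gn M (neg M B) \<in> G M U
    | Conj \<Rightarrow> gn M (neg M A) \<in> G M U \<or> gn M (neg M B) \<in> G M U
    | Imp \<Rightarrow> gn M A \<in> G M U \<and> gn M (neg M B) \<in> G M U
    | Iff \<Rightarrow> gn M A \<in> G M U \<and> gn M (neg M B) \<in> G M U \<or>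
        gn M (neg M A) \<in> G M U \<and> gn M B \<in> G M U"
proof -
  have "neg M (bin M c A B) \<in> sentences M \<or> neg M (bin M c A B) \<in> derived (G M U)"
    using G_unfold[OF assms(1)] G0_compound[of "neg M (bin M c A B)" U A c B] assms(2,3) by auto
  then show ?thesis
  proof
    assume s: "neg M (bin M c A B) \<in> sentences M"
    then have s': "bin M c A B \<in> sentences M" using assms(2,3) sentence_negD by simp
    then show ?thesis using assms(1) s sentence_binD[OF s' assms(2,3)]
      by (auto simp: G_sentence_iff true_neg true_bin sentences_neg split: connective.split)
  qed (use assms(2,3) in \<open>auto simp: derived_def Let_def\<close>)
qed

text \<open>No rule concludes a sentence about truth or its negation, so both would already be in
  \<open>G0 M U\<close>, which puts \<open>A\<close> into \<open>T_true U\<close> and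
  \<open>T_false U\<close> at once.\<close>

lemma G_T_literals:
  assumes "U \<in> consistent_sets M" "A \<in> T_sentences M"
  shows "\<not> (gn M A \<in> G M U \<and> gn M (neg M A) \<in> G M U)"
proof
  assume H: "gn M A \<in> G M U \<and> gn M (neg M A) \<in> G M U"
  have A: "A \<in> calL M" "A \<notin> sentences M"
    using assms T_sentences_calL T_sentence_not_sentence by auto
  have "A \<notin> derived V" "neg M A \<notin> derived V" for V
    using A(1) assms(2) T_sentence_not_compound by (auto simp: derived_def Let_def)
  then have G0: "gn M A \<in> G0 M U" "gn M (neg M A) \<in> G0 M U"
    using H G_unfold[OF _ A(1)] G_unfold[OF _ calL_neg[OF A(1)]] by blast+
  have "A \<in> T_true U"
    using G0(1) A(1)
    by (cases rule: G0_cases)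
      (use A assms(2) T_sentence_not_compound T_false_T_sentences T_sentences_calL in blast)+
  moreover have nA: "neg M A \<in> calL M" using A by simp
  have "A \<in> T_false U"
    using G0(2) nA
  proof (cases rule: G0_cases)
    case 1
    then show ?thesis using A sentence_negD by blast
  next
    case 2
    then show ?thesis using A T_sentence_not_compound T_true_T_sentences by blast
  next
    case (3 Y)
    moreover have "Y \<in> calL M" using 3 T_false_T_sentences T_sentences_calL by blast
    ultimately show ?thesis using A by simp
  qed
  ultimately show False using T_true_T_false[OF assms(1)] by blast
qed

lemma G_consistent:
  assumes "U \<in> consistent_sets M"
  shows "G M U \<in> consistent_sets M"
proof -
  have "\<not> (gn M A \<in> G M U \<and> gn M (neg M A) \<in> G M U)" if "A \<in> calL M" for A
    using that
  proof (induction rule: calL_induct)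
    case (sentence A)
    then show ?case by (simp add: G_sentence_iff true_neg sentences_neg)
  next
    case (T_sentence A)
    then show ?case using assms G_T_literals by blast
  next
    case (neg A)
    then show ?case using G_neg_neg by blast
  next
    \<comment> \<open>Inverting the compound and its negation leaves, for each connective, a
      contradictory pair on \<open>A\<close> or on \<open>B\<close>.\<close>
    case (bin c A B)
    then show ?case
      using G_bin[of c A B U] G_neg_bin[of c A B U] by (cases c) auto
  qed
  then show ?thesis using G_subset_D by (auto simp: consistent_sets_def)
qed

section \<open>Consistency of \<open>W\<close> and of unions of chains\<close>

lemma W_consistent: "W M \<in> consistent_sets M"
  using W_subset_D sentence_negD true_neg by (auto simp: consistent_sets_def W_iff)

text \<open>A contradiction involves only two members of the chain, and the larger of them contains
  it entirely.\<close>

lemma consistent_chain_Union: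
  assumes "\<And>X. X \<in> C \<Longrightarrow> X \<in> consistent_sets M"
    and "\<And>X Y. X \<in> C \<Longrightarrow> Y \<in> C \<Longrightarrow> X \<subseteq> Y \<or> Y \<subseteq> X"
  shows "\<Union>C \<in> consistent_sets M"
proof -
  have "\<not> (gn M A \<in> \<Union>C \<and> gn M (neg M A) \<in> \<Union>C)" if "A \<in> calL M" for A
  proof
    assume "gn M A \<in> \<Union>C \<and> gn M (neg M A) \<in> \<Union>C"
    then obtain X where "X \<in> C" "gn M A \<in> X" "gn M (neg M A) \<in> X"
      using assms(2) by blast
    then show False using assms(1) that unfolding consistent_sets_def by blast
  qed
  then show ?thesis using assms(1) unfolding consistent_sets_def by blast
qed

section \<open>Iterating \<open>G\<close>\<close>

text \<open>The recursion of the sequences, run through all ordinals of the type without demanding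
  strict increase.\<close>

function iter :: "'i ordinal \<Rightarrow> nat set" where
  "iter \<mu> = (if \<mu> = 0 then W M else \<Union>\<kappa> \<in> {..<\<mu>}. G M (iter \<kappa>))"
  by auto
termination by (relation "{(a, b). a < b}") (auto intro: wf)

declare iter.simps [simp del]

lemma iter_0: "iter 0 = W M"
  by (simp add: iter.simps)

lemma iter_pos: "0 < \<mu> \<Longrightarrow> iter \<mu> = (\<Union>\<kappa> \<in> {..<\<mu>}. G M (iter \<kappa>))"
  by (subst iter.simps) auto

lemma ordinal_pos_iff: "0 < (\<mu> :: 'i ordinal) \<longleftrightarrow> \<mu> \<noteq> 0"
  using zero_le_ordinal[of \<mu>] by (auto simp: order_le_less)

lemma G_iter_subset: "\<mu> < \<nu> \<Longrightarrow> G M (iter \<mu>) \<subseteq> iter \<nu>"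
  using zero_le_ordinal[of \<mu>] by (subst (2) iter_pos) auto

lemma iter_mono:
  assumes "\<mu> \<le> \<nu>"
  shows "iter \<mu> \<subseteq> iter \<nu>"
proof (cases "\<mu> = 0")
  case True
  then show ?thesis
    using W_subset_G G_iter_subset[of 0 \<nu>] assms by (auto simp: iter_0 order_le_less)
next
  case False
  then show ?thesis
    using assms iter_pos[of \<mu>] G_iter_subset[OF order.strict_trans2[OF _ assms]]
    by (auto simp: ordinal_pos_iff)
qed

lemma iter_subset_G: "iter \<mu> \<subseteq> G M (iter \<mu>)"
proof (cases "\<mu> = 0")
  case True
  then show ?thesis using W_subset_G by (auto simp: iter_0)
next
  case False
  have "G M (iter \<kappa>) \<subseteq> G M (iter \<mu>)" if "\<kappa> < \<mu>" for \<kappa>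
    by (rule G_mono[OF iter_mono[OF less_imp_le[OF that]]])
  then show ?thesis using False iter_pos[of \<mu>] by (auto simp: ordinal_pos_iff)
qed

lemma iter_consistent: "iter (\<mu> :: 'i ordinal) \<in> consistent_sets M"
proof (induction \<mu> rule: less_induct)
  case (less \<mu>)
  show ?case
  proof (cases "\<mu> = 0")
    case True
    then show ?thesis using W_consistent by (simp add: iter_0)
  next
    case False
    have "\<Union>((\<lambda>\<kappa>. G M (iter \<kappa>)) ` {..<\<mu>}) \<in> consistent_sets M"
    proof (rule consistent_chain_Union)
      show "X \<in> consistent_sets M" if "X \<in> (\<lambda>\<kappa>. G M (iter \<kappa>)) ` {..<\<mu>}" for X
        using that less G_consistent by auto
      show "X \<subseteq> Y \<or> Y \<subseteq> X"
        if X: "X \<in> (\<lambda>\<kappa>. G M (iter \<kappa>)) ` {..<\<mu>}"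
          and Y: "Y \<in> (\<lambda>\<kappa>. G M (iter \<kappa>)) ` {..<\<mu>}" for X Y
      proof -
        from X Y obtain a b :: "'i ordinal" where "X = G M (iter a)" "Y = G M (iter b)"
          by blast
        then show ?thesis
          using G_mono[OF iter_mono, of a b] G_mono[OF iter_mono, of b a] linear[of a b] by blast
      qed
    qed
    then show ?thesis using False iter_pos[of \<mu>] by (simp add: ordinal_pos_iff)
  qed
qed

text \<open>\<open>W M\<close> lies in \<open>G M V = V\<close>, and monotonicity propagates the
  bound. It yields minimality, and also that the iteration stops growing once it meets a fixed
  point.\<close>

lemma iter_subset_fixed:
  assumes "V = G M V"
  shows "iter \<mu> \<subseteq> V"
proof (induction \<mu> rule: less_induct)
  case (less \<mu>)
  show ?case
  proof (cases "\<mu> = 0")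
    case True
    then show ?thesis using W_subset_G[of V] assms by (simp add: iter_0)
  next
    case False
    have "G M (iter \<kappa>) \<subseteq> V" if "\<kappa> < \<mu>" for \<kappa>
      using G_mono[OF less[OF that]] assms by simp
    then show ?thesis using False iter_pos[of \<mu>] by (auto simp: ordinal_pos_iff)
  qed
qed

text \<open>At each index in \<open>K\<close> choose a number that \<open>G\<close> newly adds. All
  later members contain it, so the choices are distinct and inject \<open>K\<close> into
  \<open>nat\<close>.\<close>

lemma countable_below_fixed:
  fixes K :: "'i ordinal set"
  assumes "\<And>\<mu>. \<mu> \<in> K \<Longrightarrow> G M (iter \<mu>) \<noteq> iter \<mu>"
  shows "countable K"
proof -
  have "\<exists>n. n \<in> G M (iter \<mu>) - iter \<mu>" if "\<mu> \<in> K" for \<mu>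
    using assms[OF that] iter_subset_G[of \<mu>] by blast
  then obtain e where e: "\<And>\<mu>. \<mu> \<in> K \<Longrightarrow> e \<mu> \<in> G M (iter \<mu>) - iter \<mu>"
    by metis
  have "e \<mu> \<noteq> e \<nu>" if "\<mu> < \<nu>" "\<mu> \<in> K" "\<nu> \<in> K" for \<mu> \<nu>
    using e[of \<mu>] e[of \<nu>] that G_iter_subset[of \<mu> \<nu>] by auto
  then have "inj_on e K"
    by (auto simp: linorder_inj_onI')
  then show ?thesis by (rule countableI)
qed

text \<open>The clauses for \<open>0\<close> and for positive indices determine every member, so any
  two sequences agree where both are defined.\<close>

lemma G_sequence_eq_iter:
  assumes "G_sequence M \<alpha> U" "\<mu> < \<alpha>"
  shows "U \<mu> = iter \<mu>"
  using assms(2)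
proof (induction \<mu> rule: less_induct)
  case (less \<mu>)
  show ?case
  proof (cases "\<mu> = 0")
    case True
    then show ?thesis using assms(1) less.prems by (simp add: G_sequence_def iter_0)
  next
    case False
    then have "U \<mu> = (\<Union>\<kappa> \<in> {..<\<mu>}. G M (U \<kappa>))"
      using assms(1) less.prems by (simp add: G_sequence_def ordinal_pos_iff)
    also have "\<dots> = (\<Union>\<kappa> \<in> {..<\<mu>}. G M (iter \<kappa>))"
      using less by (intro SUP_cong) auto
    finally show ?thesis using False iter_pos[of \<mu>] by (simp add: ordinal_pos_iff)
  qed
qed

lemma union_of_G_sequences_last:
  fixes S :: "('i::infinite ordinal \<times> nat set) set"
  assumes S: "S = union_of_G_sequences M"
  shows "transfinite_sequence S \<and>
    (\<exists>U. last_member S U \<and> U \<in> consistent_sets M \<and> U = G M U \<and>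
       (\<forall>V \<in> consistent_sets M. V = G M V \<longrightarrow> U \<subseteq> V))"
proof -
  have "\<exists>\<mu> :: 'i ordinal. G M (iter \<mu>) = iter \<mu>"
    using countable_below_fixed[of "UNIV :: 'i ordinal set"] uncountable_ordinal by blast
  then obtain \<gamma> :: "'i ordinal" where fixed: "G M (iter \<gamma>) = iter \<gamma>"
    and least: "\<And>\<mu>. \<mu> < \<gamma> \<Longrightarrow> G M (iter \<mu>) \<noteq> iter \<mu>"
    using exists_least_iff[of "\<lambda>\<mu> :: 'i ordinal. G M (iter \<mu>) = iter \<mu>"] by blast
  \<comment> \<open>An ordinal above \<open>\<gamma>\<close> must be found within the type: by
    minimality \<open>\<gamma>\<close> has only countably many predecessors, while the type is
    uncountable.\<close>
  have "countable (insert \<gamma> {..<\<gamma>})"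
    using countable_below_fixed[of "{..<\<gamma>}"] least by simp
  then obtain \<beta> where "\<beta> \<notin> insert \<gamma> {..<\<gamma>}"
    using uncountable_ordinal[where 'i = 'i] by (metis UNIV_eq_I)
  then have "\<gamma> < \<beta>" by auto
  \<comment> \<open>\<open>\<alpha>\<close> is the successor of \<open>\<gamma>\<close>, so that a
    sequence of length \<open>\<alpha>\<close> has \<open>\<gamma>\<close> as its last
    index.\<close>
  then obtain \<alpha> where "\<gamma> < \<alpha>" and "\<And>\<mu>. \<mu> < \<alpha> \<Longrightarrow> \<not> \<gamma> < \<mu>"
    using exists_least_iff[of "\<lambda>\<mu>. \<gamma> < \<mu>"] by blast
  then have below: "\<mu> < \<alpha> \<longleftrightarrow> \<mu> \<le> \<gamma>" for \<mu>
    by (meson leD leI order.strict_trans1)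
  have seq: "G_sequence M \<alpha> iter"
    unfolding G_sequence_def
  proof (intro conjI allI impI)
    fix \<mu> \<nu> :: "'i ordinal"
    assume "\<mu> < \<nu> \<and> \<nu> < \<alpha>"
    then have "\<mu> < \<nu>" "\<mu> < \<gamma>" using below less_le_trans by blast+
    then show "iter \<mu> \<subset> iter \<nu>"
      using G_iter_subset[of \<mu> \<nu>] iter_subset_G[of \<mu>] least[of \<mu>] by blast
  qed (auto simp: iter_consistent iter_0 iter_pos)
  \<comment> \<open>A sequence reaching beyond \<open>\<gamma>\<close> would have to grow strictly
    there, but \<open>iter\<close> is stationary from \<open>\<gamma>\<close> on.\<close>
  have max: "\<mu> \<le> \<gamma>" if U: "G_sequence M \<alpha>' U" and \<mu>: "\<mu> < \<alpha>'" for \<alpha>' U \<mu>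
  proof (rule ccontr)
    assume "\<not> \<mu> \<le> \<gamma>"
    then have "\<gamma> < \<mu>" by simp
    then have "iter \<gamma> \<subset> iter \<mu>"
      using U \<mu> G_sequence_eq_iter[OF U] unfolding G_sequence_def
      by (metis order.strict_trans)
    moreover have "iter \<mu> \<subseteq> iter \<gamma>"
      by (rule iter_subset_fixed) (simp add: fixed)
    ultimately show False by blast
  qed
  have S_eq: "S = seq_graph \<alpha> iter"
  proof
    show "S \<subseteq> seq_graph \<alpha> iter"
      unfolding S union_of_G_sequences_def seq_graph_def
      using max G_sequence_eq_iter below by fastforce
    show "seq_graph \<alpha> iter \<subseteq> S"
      unfolding S union_of_G_sequences_def using seq by blast
  qed
  have "last_member S (iter \<gamma>)"
    unfolding last_member_def S_eq seq_graph_def using below by auto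
  moreover have "transfinite_sequence S"
    using S_eq by (auto simp: transfinite_sequence_def)
  moreover have "\<forall>V \<in> consistent_sets M. V = G M V \<longrightarrow> iter \<gamma> \<subseteq> V"
    by (intro ballI impI) (rule iter_subset_fixed)
  ultimately show ?thesis
    by (intro conjI exI[of _ "iter \<gamma>"]) (assumption | rule iter_consistent fixed[symmetric])+
qed

end

theorem theorem6p1:
  fixes M :: "('c, 'x) truth_language"
    and S :: "('i::infinite ordinal \<times> nat set) set"
  assumes "fully_interpreted M"
    and "truth_extension M"
    and "\<not> (\<exists>P. truth_predicate M P)"
    and "S = union_of_G_sequences M"
  shows "transfinite_sequence S \<and>
    (\<exists>U. last_member S U \<and>
       U \<in> consistent_sets M \<and> U = G M U \<and>
       (\<forall>V \<in> consistent_sets M. V = G M V \<longrightarrow> U \<subseteq> V))"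
proof -
  interpret truth_extension_of_interpreted M
    using assms(1,2) by unfold_locales
  show ?thesis
    using assms(4) by (rule union_of_G_sequences_last)
qed

end
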